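(* For any finite Coxeter group $W$, the number of transitive $2$-colorings of the set $\Phi^+(W)$ of positive roots is equal to $|W|$.
   Context: $\Phi^+(W)$ is the set of positive roots of the root system of $W$, viewed as a finite set of vectors in the real geometric representation. A transitive $2$-coloring of a finite set $E$ of vectors in a real vector space is a function $\varepsilon:E\to\{1,2\}$ such that for any two disjoint (nonempty) subsets $S,T\subseteq E$: if $\operatorname{span}_{\mathbb{R}_{>0}}(S)\cap\operatorname{span}_{\mathbb{R}_{>0}}(T)\neq\varnothing$ then $\varepsilon(S)\cap\varepsilon(T)\neq\varnothing$, where $\operatorname{span}_{\mathbb{R}_{>0}}(S)$ is the set of linear combinations of all elements of $S$ with strictly positive coefficients. Equivalently, $\varepsilon(X^+)\cap\varepsilon(X^-)\neq\varnothing$ for every signed circuit $(X^+,X^-)$ of the oriented matroid of linear dependencies of $E$. *)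

theory Defs
  imports
    "HOL-Algebra.Generated_Groups"
    "HOL-Analysis.Finite_Function_Topology"
    "HOL-Library.FuncSet"
begin

section \<open>Coxeter systems\<close>

text \<open>
  A Coxeter matrix is a function \<open>m\<close> on pairs of generators, where the value \<open>0\<close> encodes
  \<open>m(s,t) = \<infinity>\<close>, i.e. the absence of a relation between \<open>s\<close> and \<open>t\<close>.

  The presentation is expressed through words in the free monoid on \<open>S\<close>, modulo insertion and
  deletion of the relators \<open>(st)\<^sup>m\<^sup>(\<^sup>s\<^sup>,\<^sup>t\<^sup>)\<close>. As the relators \<open>ss\<close> are among them, no formal inverses
  of generators are needed.
\<close>

inductive insert_relator :: "'a set \<Rightarrow> ('a \<Rightarrow> 'a \<Rightarrow> nat) \<Rightarrow> 'a list \<Rightarrow> 'a list \<Rightarrow> bool"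
  for S m where
  "\<lbrakk>us \<in> lists S; vs \<in> lists S; s \<in> S; t \<in> S; m s t \<noteq> 0\<rbrakk>
    \<Longrightarrow> insert_relator S m (us @ vs) (us @ concat (replicate (m s t) [s, t]) @ vs)"

definition (in monoid) word_prod :: "'a list \<Rightarrow> 'a" where
  "word_prod ws = foldr (\<otimes>) ws \<one>"

locale coxeter_system = group G for G (structure) +
  fixes S :: "'a set" and m :: "'a \<Rightarrow> 'a \<Rightarrow> nat"
  assumes generators_closed: "S \<subseteq> carrier G"
    and matrix_diag: "s \<in> S \<Longrightarrow> m s s = 1"
    and matrix_off_diag: "\<lbrakk>s \<in> S; t \<in> S; s \<noteq> t\<rbrakk> \<Longrightarrow> m s t \<noteq> 1"
    and matrix_sym: "\<lbrakk>s \<in> S; t \<in> S\<rbrakk> \<Longrightarrow> m s t = m t s"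
    and generated: "generate G S = carrier G"
    and presentation: "\<lbrakk>us \<in> lists S; vs \<in> lists S\<rbrakk>
      \<Longrightarrow> word_prod us = word_prod vs \<longleftrightarrow> equivclp (insert_relator S m) us vs"


section \<open>Geometric representation and roots\<close>

text \<open>
  The geometric representation lives on the real vector space with basis \<open>S\<close>, which consists of
  the finitely supported functions \<open>v :: 'a \<Rightarrow>\<^sub>0 real\<close> with \<open>Poly_Mapping.keys v \<subseteq> S\<close>.
\<close>

definition simple_root :: "'a \<Rightarrow> 'a \<Rightarrow>\<^sub>0 real" where
  "simple_root s = Poly_Mapping.single s 1"

definition coxeter_form :: "('a \<Rightarrow> 'a \<Rightarrow> nat) \<Rightarrow> ('a \<Rightarrow>\<^sub>0 real) \<Rightarrow> ('a \<Rightarrow>\<^sub>0 real) \<Rightarrow> real" where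
  "coxeter_form m u v =
    (\<Sum>s\<in>Poly_Mapping.keys u. \<Sum>t\<in>Poly_Mapping.keys v.
      Poly_Mapping.lookup u s * Poly_Mapping.lookup v t *
      (if m s t = 0 then - 1 else - cos (pi / real (m s t))))"

definition simple_reflection :: "('a \<Rightarrow> 'a \<Rightarrow> nat) \<Rightarrow> 'a \<Rightarrow> ('a \<Rightarrow>\<^sub>0 real) \<Rightarrow> ('a \<Rightarrow>\<^sub>0 real)" where
  "simple_reflection m s v = v - (2 * coxeter_form m (simple_root s) v) *\<^sub>R simple_root s"

text \<open>
  In a Coxeter system, a group element acts by \<open>foldr (simple_reflection m) ws\<close> for any word \<open>ws\<close>
  in the generators representing it. The roots are the images of the simple roots under the group.
\<close>

definition roots :: "'a set \<Rightarrow> ('a \<Rightarrow> 'a \<Rightarrow> nat) \<Rightarrow> ('a \<Rightarrow>\<^sub>0 real) set" where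
  "roots S m = {foldr (simple_reflection m) ws (simple_root s) | ws s. ws \<in> lists S \<and> s \<in> S}"

definition positive_roots :: "'a set \<Rightarrow> ('a \<Rightarrow> 'a \<Rightarrow> nat) \<Rightarrow> ('a \<Rightarrow>\<^sub>0 real) set" where
  "positive_roots S m = {\<beta> \<in> roots S m. \<forall>s\<in>S. Poly_Mapping.lookup \<beta> s \<ge> 0}"


section \<open>Transitive 2-colorings\<close>

definition pos_span :: "'v::real_vector set \<Rightarrow> 'v set" where
  "pos_span S = {\<Sum>v\<in>S. c v *\<^sub>R v | c. \<forall>v\<in>S. c v > (0::real)}"

text \<open>
  The next two notions are meant for finite \<open>E\<close>. Colorings of \<open>E\<close> are taken to be extensional, so
  that they can be counted as functions on \<open>E\<close>.
\<close>

definition transitive_coloring :: "'v::real_vector set \<Rightarrow> ('v \<Rightarrow> nat) \<Rightarrow> bool" where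
  "transitive_coloring E \<epsilon> \<longleftrightarrow>
    (\<forall>S T. S \<subseteq> E \<and> T \<subseteq> E \<and> S \<noteq> {} \<and> T \<noteq> {} \<and> S \<inter> T = {} \<and> pos_span S \<inter> pos_span T \<noteq> {}
      \<longrightarrow> \<epsilon> ` S \<inter> \<epsilon> ` T \<noteq> {})"

definition transitive_2_colorings :: "'v::real_vector set \<Rightarrow> ('v \<Rightarrow> nat) set" where
  "transitive_2_colorings E = {\<epsilon> \<in> E \<rightarrow>\<^sub>E {1, 2}. transitive_coloring E \<epsilon>}"

end

theory Submission
  imports Defs
begin

text \<open>
  To \<open>g \<in> W\<close> belongs the coloring of a positive root \<open>\<beta>\<close> by the sign of \<open>g \<beta>\<close>; applying \<open>g\<close>
  to a linear relation shows that it is transitive. That every root has a sign, and that \<open>g\<close> is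
  determined by the signs, follows from the fact that \<open>g \<alpha>\<^sub>s\<close> is positive unless \<open>g s\<close> is
  shorter than \<open>g\<close>. Conversely, a transitive coloring that is not constantly \<open>1\<close> gives color \<open>2\<close>
  to some simple root \<open>\<alpha>\<^sub>s\<close>, as a positive root is a nonnegative combination of simple roots. The
  reflection \<open>s\<close> permutes the positive roots other than \<open>\<alpha>\<^sub>s\<close>, so transporting the coloring along
  \<open>s\<close> and recoloring \<open>\<alpha>\<^sub>s\<close> by \<open>1\<close> yields a transitive coloring with fewer roots of color \<open>2\<close>,
  and induction applies.
\<close>

section \<open>The bilinear form and its reflections\<close>

lemma lookup_scaleR [simp]:
  fixes v :: "'a \<Rightarrow>\<^sub>0 real"
  shows "Poly_Mapping.lookup (c *\<^sub>R v) i = c * Poly_Mapping.lookup v i"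
proof -
  have "{i. c *\<^sub>R Poly_Mapping.lookup v i \<noteq> 0} \<subseteq> Poly_Mapping.keys v"
    by (auto simp: in_keys_iff)
  then have "finite {i. c *\<^sub>R Poly_Mapping.lookup v i \<noteq> 0}"
    by (rule finite_subset) simp
  then show ?thesis
    by (simp add: scaleR_poly_mapping_def)
qed

text \<open>The supports in the defining sum change under addition and scaling. A common finite
  index set lets the linearity proofs compare the sums term by term.\<close>

lemma coxeter_form_superset:
  assumes "finite A" "Poly_Mapping.keys u \<subseteq> A" "Poly_Mapping.keys v \<subseteq> A"
  shows "coxeter_form m u v = (\<Sum>s\<in>A. \<Sum>t\<in>A.
    Poly_Mapping.lookup u s * Poly_Mapping.lookup v t *
      (if m s t = 0 then - 1 else - cos (pi / real (m s t))))"
  unfolding coxeter_form_def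
proof (rule sum.mono_neutral_cong_left[OF assms(1,2)])
  show "\<forall>i\<in>A - Poly_Mapping.keys u. (\<Sum>t\<in>A. Poly_Mapping.lookup u i * Poly_Mapping.lookup v t *
      (if m i t = 0 then - 1 else - cos (pi / real (m i t)))) = 0"
    by (auto simp: in_keys_iff)
qed (intro sum.mono_neutral_cong_left assms, auto simp: in_keys_iff)

lemma linear_coxeter_form_right: "linear (coxeter_form m u)"
proof (rule linearI)
  fix v w :: "'a \<Rightarrow>\<^sub>0 real"
  let ?A = "Poly_Mapping.keys u \<union> Poly_Mapping.keys v \<union> Poly_Mapping.keys w"
  have "Poly_Mapping.keys (v + w) \<subseteq> ?A"
    using keys_add[of v w] by auto
  then show "coxeter_form m u (v + w) = coxeter_form m u v + coxeter_form m u w"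
    by (subst (1 2 3) coxeter_form_superset[where A = ?A])
       (auto simp: lookup_add algebra_simps simp flip: sum.distrib intro!: sum.cong)
next
  fix c :: real and v :: "'a \<Rightarrow>\<^sub>0 real"
  let ?A = "Poly_Mapping.keys u \<union> Poly_Mapping.keys v"
  have "Poly_Mapping.keys (c *\<^sub>R v) \<subseteq> ?A"
    by (auto simp: in_keys_iff)
  then show "coxeter_form m u (c *\<^sub>R v) = c *\<^sub>R coxeter_form m u v"
    by (subst (1 2) coxeter_form_superset[where A = ?A])
       (auto simp: sum_distrib_left intro!: sum.cong)
qed

lemma linear_coxeter_form_left: "linear (\<lambda>u. coxeter_form m u v)"
proof (rule linearI)
  fix u w :: "'a \<Rightarrow>\<^sub>0 real"
  let ?A = "Poly_Mapping.keys u \<union> Poly_Mapping.keys v \<union> Poly_Mapping.keys w"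
  have "Poly_Mapping.keys (u + w) \<subseteq> ?A"
    using keys_add[of u w] by auto
  then show "coxeter_form m (u + w) v = coxeter_form m u v + coxeter_form m w v"
    by (subst (1 2 3) coxeter_form_superset[where A = ?A])
       (auto simp: lookup_add algebra_simps simp flip: sum.distrib intro!: sum.cong)
next
  fix c :: real and u :: "'a \<Rightarrow>\<^sub>0 real"
  let ?A = "Poly_Mapping.keys u \<union> Poly_Mapping.keys v"
  have "Poly_Mapping.keys (c *\<^sub>R u) \<subseteq> ?A"
    by (auto simp: in_keys_iff)
  then show "coxeter_form m (c *\<^sub>R u) v = c *\<^sub>R coxeter_form m u v"
    by (subst (1 2) coxeter_form_superset[where A = ?A])
       (auto simp: sum_distrib_left intro!: sum.cong)
qed

lemmas coxeter_form_simps =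
  linear_add[OF linear_coxeter_form_right] linear_diff[OF linear_coxeter_form_right]
  linear_scale[OF linear_coxeter_form_right] linear_neg[OF linear_coxeter_form_right]
  linear_add[OF linear_coxeter_form_left] linear_diff[OF linear_coxeter_form_left]
  linear_scale[OF linear_coxeter_form_left] linear_neg[OF linear_coxeter_form_left]

text \<open>A Coxeter matrix is symmetric only on \<open>S\<close>, so both supports have to lie
  there.\<close>

lemma coxeter_form_commute:
  assumes "\<And>s t. \<lbrakk>s \<in> S; t \<in> S\<rbrakk> \<Longrightarrow> m s t = m t s"
    and "Poly_Mapping.keys u \<subseteq> S" "Poly_Mapping.keys v \<subseteq> S"
  shows "coxeter_form m u v = coxeter_form m v u"
  unfolding coxeter_form_def
  by (subst sum.swap, intro sum.cong refl) (use assms in \<open>auto simp: subset_iff mult_ac\<close>)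

lemma coxeter_form_simple_root:
  "coxeter_form m (simple_root s) (simple_root t) =
    (if m s t = 0 then - 1 else - cos (pi / real (m s t)))"
  by (simp add: coxeter_form_def simple_root_def)

lemma linear_simple_reflection: "linear (simple_reflection m s)"
  by (rule linearI) (simp_all add: simple_reflection_def coxeter_form_simps algebra_simps)

lemma linear_foldr_simple_reflection: "linear (foldr (simple_reflection m) ws)"
proof (induction ws)
  case Nil
  show ?case by (simp add: linearI)
next
  case (Cons s ws)
  then show ?case
    using linear_compose[OF _ linear_simple_reflection] by (simp add: o_def)
qed

lemma simple_root_nonzero: "simple_root s \<noteq> 0"
  by (metis keys_single keys_zero insert_not_empty simple_root_def zero_neq_one)

lemma lookup_simple_root:
  "Poly_Mapping.lookup (simple_root s) t = (if s = t then 1 else 0)"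
  by (simp add: simple_root_def lookup_single when_def)

lemma keys_simple_root: "Poly_Mapping.keys (simple_root s) = {s}"
  by (simp add: simple_root_def)

lemma keys_simple_reflection:
  "Poly_Mapping.keys (simple_reflection m s v) \<subseteq> insert s (Poly_Mapping.keys v)"
  by (auto simp: simple_reflection_def in_keys_iff lookup_minus lookup_simple_root split: if_splits)

lemma keys_foldr_simple_reflection:
  "ws \<in> lists S \<Longrightarrow> Poly_Mapping.keys v \<subseteq> S \<Longrightarrow>
    Poly_Mapping.keys (foldr (simple_reflection m) ws v) \<subseteq> S"
  using keys_simple_reflection by (induction ws) fastforce+

lemma lookup_simple_reflection:
  "t \<noteq> s \<Longrightarrow> Poly_Mapping.lookup (simple_reflection m s v) t = Poly_Mapping.lookup v t"
  by (simp add: simple_reflection_def lookup_minus lookup_simple_root)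

section \<open>The cone of vectors with nonnegative coordinates\<close>

definition nonneg :: "('a \<Rightarrow>\<^sub>0 real) \<Rightarrow> bool" where
  "nonneg v \<longleftrightarrow> (\<forall>i. 0 \<le> Poly_Mapping.lookup v i)"

lemma nonneg_antisym: "nonneg v \<Longrightarrow> nonneg (- v) \<Longrightarrow> v = 0"
  by (intro poly_mapping_eqI) (auto simp: nonneg_def intro: antisym)

text \<open>In a coordinate where \<open>f v\<close> is nonzero, a sum of nonnegative terms
  vanishes, so each term does. The family \<open>f\<close> allows for two uses: with the positive
  roots themselves, and with their images under a group element, corrected by signs.\<close>

lemma nonneg_combination_eq_0:
  assumes "finite E" "\<And>v. v \<in> E \<Longrightarrow> nonneg (f v)" "\<And>v. v \<in> E \<Longrightarrow> f v \<noteq> 0"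
    and "\<And>v. v \<in> E \<Longrightarrow> 0 \<le> c v" "(\<Sum>v\<in>E. c v *\<^sub>R f v) = 0"
  shows "\<forall>v\<in>E. c v = 0"
proof
  fix v assume v: "v \<in> E"
  then obtain i where i: "Poly_Mapping.lookup (f v) i \<noteq> 0"
    using assms(3) by (metis lookup_zero poly_mapping_eqI)
  have "(\<Sum>v\<in>E. c v * Poly_Mapping.lookup (f v) i) = Poly_Mapping.lookup (\<Sum>v\<in>E. c v *\<^sub>R f v) i"
    by (simp add: lookup_sum)
  also have "\<dots> = 0" using assms(5) by simp
  finally have "c v * Poly_Mapping.lookup (f v) i = 0"
    using assms v by (subst (asm) sum_nonneg_eq_0_iff) (auto simp: nonneg_def)
  with i show "c v = 0" by simp
qed

section \<open>Transitive colorings as sign vectors\<close>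

text \<open>
  Unlike the definition, a signed relation needs no case distinction when a simple reflection
  moves a vector from one color class to the other.
\<close>

lemma transitive_coloring_iff_signed_relation:
  fixes E :: "'v::real_vector set"
  assumes fin: "finite E"
    and pointed: "\<And>c. \<lbrakk>\<And>v. v \<in> E \<Longrightarrow> (0::real) \<le> c v; (\<Sum>v\<in>E. c v *\<^sub>R v) = 0\<rbrakk> \<Longrightarrow> \<forall>v\<in>E. c v = 0"
    and col: "\<epsilon> \<in> E \<rightarrow> {1, 2::nat}"
  shows "transitive_coloring E \<epsilon> \<longleftrightarrow>
    (\<forall>c. (\<forall>v\<in>E. (0::real) \<le> c v) \<and> (\<Sum>v\<in>E. (c v * (if \<epsilon> v = 1 then 1 else - 1)) *\<^sub>R v) = 0
      \<longrightarrow> (\<forall>v\<in>E. c v = 0))" (is "?L \<longleftrightarrow> ?R")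
proof
  assume L: ?L
  show ?R
  proof (intro allI impI, elim conjE)
    fix c :: "'v \<Rightarrow> real"
    assume nonneg: "\<forall>v\<in>E. 0 \<le> c v"
      and rel: "(\<Sum>v\<in>E. (c v * (if \<epsilon> v = 1 then 1 else - 1)) *\<^sub>R v) = 0"
    define A where "A = {v\<in>E. \<epsilon> v = 1 \<and> c v > 0}"
    define B where "B = {v\<in>E. \<epsilon> v \<noteq> 1 \<and> c v > 0}"
    have AB: "A \<subseteq> E" "B \<subseteq> E" "A \<inter> B = {}" "finite A" "finite B"
      using fin by (auto simp: A_def B_def)
    have "(\<Sum>v\<in>E. (c v * (if \<epsilon> v = 1 then 1 else - 1)) *\<^sub>R v)
        = (\<Sum>v\<in>A \<union> B. (c v * (if \<epsilon> v = 1 then 1 else - 1)) *\<^sub>R v)"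
      by (rule sum.mono_neutral_right[OF fin])
         (use nonneg in \<open>force simp: A_def B_def\<close>)+
    also have "\<dots> = (\<Sum>v\<in>A. c v *\<^sub>R v) + (\<Sum>v\<in>B. - (c v *\<^sub>R v))"
      by (subst sum.union_disjoint[OF AB(4,5,3)], intro arg_cong2[of _ _ _ _ "(+)"] sum.cong)
         (auto simp: A_def B_def)
    finally have eq: "(\<Sum>v\<in>A. c v *\<^sub>R v) = (\<Sum>v\<in>B. c v *\<^sub>R v)"
      using rel by (simp add: sum_negf)
    \<comment> \<open>This covers an empty color class, about which the definition of a transitive
      coloring says nothing: both partial sums vanish, hence so does the unsigned sum, and
      \<open>pointed\<close> applies.\<close>
    have zero: "\<forall>v\<in>E. c v = 0" if "(\<Sum>v\<in>A. c v *\<^sub>R v) = 0"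
    proof -
      have "(\<Sum>v\<in>E. c v *\<^sub>R v) = (\<Sum>v\<in>A \<union> B. c v *\<^sub>R v)"
        by (rule sum.mono_neutral_right[OF fin])
           (use nonneg in \<open>force simp: A_def B_def\<close>)+
      also have "\<dots> = 0"
        using that eq by (simp add: sum.union_disjoint AB)
      finally show ?thesis using pointed nonneg by blast
    qed
    show "\<forall>v\<in>E. c v = 0"
    proof (cases "A = {} \<or> B = {}")
      case True
      then show ?thesis using zero eq by auto
    next
      case False
      have "(\<Sum>v\<in>A. c v *\<^sub>R v) \<in> pos_span A \<inter> pos_span B"
        unfolding pos_span_def by (auto simp: A_def B_def eq intro!: exI[of _ c] simp flip: eq)
           (use eq in \<open>auto simp: A_def B_def\<close>)
      then have "\<epsilon> ` A \<inter> \<epsilon> ` B \<noteq> {}"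
        using L False AB unfolding transitive_coloring_def by blast
      then show ?thesis by (auto simp: A_def B_def)
    qed
  qed
next
  assume R: ?R
  \<comment> \<open>With two colors, sets without a common color are monochromatic, and exactly one
    of them has color 1. So it suffices to refute this case, which is used below in both
    orders.\<close>
  have no_overlap: False
    if A: "A \<subseteq> E" "A \<noteq> {}" "\<forall>v\<in>A. \<epsilon> v = 1" and B: "B \<subseteq> E" "\<forall>v\<in>B. \<epsilon> v \<noteq> 1"
      and ne: "pos_span A \<inter> pos_span B \<noteq> {}" for A B
  proof -
    from ne obtain a b where a: "\<forall>v\<in>A. a v > (0::real)" and b: "\<forall>v\<in>B. b v > (0::real)"
      and eq: "(\<Sum>v\<in>A. a v *\<^sub>R v) = (\<Sum>v\<in>B. b v *\<^sub>R v)"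
      by (auto simp: pos_span_def)
    define c where "c v = (if v \<in> A then a v else if v \<in> B then b v else 0)" for v
    have disj: "A \<inter> B = {}" using A B by auto
    have "(\<Sum>v\<in>E. (c v * (if \<epsilon> v = 1 then 1 else - 1)) *\<^sub>R v)
        = (\<Sum>v\<in>A \<union> B. (c v * (if \<epsilon> v = 1 then 1 else - 1)) *\<^sub>R v)"
      by (rule sum.mono_neutral_right[OF fin]) (use A B in \<open>auto simp: c_def\<close>)
    also have "\<dots> = (\<Sum>v\<in>A. a v *\<^sub>R v) + (\<Sum>v\<in>B. - (b v *\<^sub>R v))"
      by (subst sum.union_disjoint[OF _ _ disj])
         (use A B disj finite_subset[OF _ fin] in
           \<open>auto simp: c_def intro!: arg_cong2[of _ _ _ _ "(+)"] sum.cong\<close>)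
    also have "\<dots> = 0" using eq by (simp add: sum_negf)
    finally have "\<forall>v\<in>E. c v = 0"
      using R[rule_format, of c] a b by (auto simp: c_def less_imp_le)
    with A a show False by (force simp: c_def)
  qed
  show ?L
    unfolding transitive_coloring_def
  proof (intro allI impI notI, elim conjE)
    fix A B
    assume AB: "A \<subseteq> E" "B \<subseteq> E" "A \<noteq> {}" "B \<noteq> {}" "pos_span A \<inter> pos_span B \<noteq> {}"
      and disj: "\<epsilon> ` A \<inter> \<epsilon> ` B = {}"
    have "(\<forall>v\<in>A. \<epsilon> v = 1) \<and> (\<forall>v\<in>B. \<epsilon> v \<noteq> 1) \<or> (\<forall>v\<in>A. \<epsilon> v \<noteq> 1) \<and> (\<forall>v\<in>B. \<epsilon> v = 1)"
    proof -
      obtain a b where ab: "a \<in> A" "b \<in> B" using AB by blast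
      have "\<forall>v\<in>A. \<epsilon> v \<noteq> \<epsilon> b" "\<forall>v\<in>B. \<epsilon> v \<noteq> \<epsilon> a"
        using disj ab by (metis disjoint_iff image_eqI)+
      moreover have "\<forall>v\<in>A \<union> B. \<epsilon> v = 1 \<or> \<epsilon> v = 2"
        using col AB by blast
      ultimately show ?thesis
        using ab by (metis Un_iff)
    qed
    then show False
      using no_overlap[of A B] no_overlap[of B A] AB by (auto simp: Int_commute)
  qed
qed

section \<open>Rank two\<close>

text \<open>The last letter is fixed to be \<open>t\<close> and the first one depends on the parity.
  Growth on the left suits \<open>foldr\<close>, which applies the leftmost reflection last.\<close>

fun alternating :: "'a \<Rightarrow> 'a \<Rightarrow> nat \<Rightarrow> 'a list" where
  "alternating s t 0 = []"
| "alternating s t (Suc n) = (if even n then t else s) # alternating s t n"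

lemma length_alternating [simp]: "length (alternating s t n) = n"
  by (induction n) auto

lemma alternating_in_lists: "s \<in> S \<Longrightarrow> t \<in> S \<Longrightarrow> alternating s t n \<in> lists S"
  by (induction n) auto

lemma alternating_snoc: "alternating s t (Suc n) = alternating t s n @ [t]"
  by (induction n) auto

lemma concat_replicate_eq_alternating: "concat (replicate n [s, t]) = alternating s t (2 * n)"
  by (induction n) auto

lemma simple_reflection_simple_root_self:
  assumes "m s s = 1"
  shows "simple_reflection m s (simple_root s) = - simple_root s"
  using assms by (simp add: simple_reflection_def coxeter_form_simple_root scaleR_2)

lemma simple_reflection_involution:
  assumes "m s s = 1"
  shows "simple_reflection m s (simple_reflection m s v) = v"
  using assms
  by (simp add: simple_reflection_def coxeter_form_simps coxeter_form_simple_root)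

text \<open>The sequence \<open>a\<close> is \<open>sin (n\<theta>) / sin \<theta>\<close>, or its limit \<open>n\<close> when \<open>\<theta> = 0\<close>.\<close>

lemma chebyshev_sequence:
  fixes k :: nat
  assumes "k \<noteq> 1"
  obtains a :: "nat \<Rightarrow> real" where
    "a 0 = 0" "a 1 = 1"
    "\<And>n. a (Suc (Suc n)) = 2 * (if k = 0 then 1 else cos (pi / real k)) * a (Suc n) - a n"
    "\<And>n. k = 0 \<or> n \<le> k \<Longrightarrow> 0 \<le> a n"
    "k \<noteq> 0 \<Longrightarrow> a (2 * k) = 0" "k \<noteq> 0 \<Longrightarrow> a (2 * k + 1) = 1" "k \<noteq> 0 \<Longrightarrow> a (2 * k - 1) = - 1"
proof (cases "k = 0")
  case True
  then show ?thesis by (intro that[of real]) auto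
next
  case False
  define \<theta> where "\<theta> = pi / real k"
  have k: "real k * \<theta> = pi" "k \<ge> 2" using False assms by (auto simp: \<theta>_def)
  have \<theta>: "0 < \<theta>" "\<theta> < pi"
    using k(2) by (auto simp: \<theta>_def field_simps)
  then have pos: "sin \<theta> > 0" by (rule sin_gt_zero)
  \<comment> \<open>The relator has \<open>2 * k\<close> letters, a full period of the sine; this
    gives the last three values.\<close>
  have two_pi: "real (2 * k) * \<theta> = 2 * pi" using k(1) by simp
  show ?thesis
  proof (rule that[of "\<lambda>n. sin (real n * \<theta>) / sin \<theta>"])
    fix n
    have "sin (real (Suc (Suc n)) * \<theta>) = sin (real (Suc n) * \<theta> + \<theta>)"
      "sin (real n * \<theta>) = sin (real (Suc n) * \<theta> - \<theta>)"
      by (simp_all add: algebra_simps)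
    then have "sin (real (Suc (Suc n)) * \<theta>) = 2 * cos \<theta> * sin (real (Suc n) * \<theta>) - sin (real n * \<theta>)"
      by (simp add: sin_add sin_diff)
    then show "sin (real (Suc (Suc n)) * \<theta>) / sin \<theta>
      = 2 * (if k = 0 then 1 else cos (pi / real k)) * (sin (real (Suc n) * \<theta>) / sin \<theta>)
        - sin (real n * \<theta>) / sin \<theta>"
      using False by (simp add: \<theta>_def[symmetric] diff_divide_distrib)
  next
    fix n assume "k = 0 \<or> n \<le> k"
    then have "real n * \<theta> \<le> real k * \<theta>"
      using \<theta> False by (intro mult_right_mono) auto
    then have "real n * \<theta> \<le> pi" by (simp add: k)
    then show "0 \<le> sin (real n * \<theta>) / sin \<theta>"
      using \<theta> pos by (intro divide_nonneg_nonneg sin_ge_zero) auto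
  next
    show "sin (real (2 * k) * \<theta>) / sin \<theta> = 0"
      by (simp only: two_pi) simp
    have "real (2 * k + 1) * \<theta> = 2 * pi + \<theta>" using k(1) by (simp add: algebra_simps)
    then show "sin (real (2 * k + 1) * \<theta>) / sin \<theta> = 1"
      using pos by (simp only:) (simp add: sin_add)
    have "real (2 * k - 1) * \<theta> = 2 * pi - \<theta>" using k by (simp add: algebra_simps of_nat_diff)
    then show "sin (real (2 * k - 1) * \<theta>) / sin \<theta> = - 1"
      using pos by (simp only:) (simp add: sin_diff)
  qed (use pos in auto)
qed

text \<open>The next letter changes only the coefficient of its own simple root, from
  \<open>a n\<close> to \<open>2 * c * a (Suc n) - a n\<close>, which is the recursion of
  \<open>a\<close>. The two roots exchange roles with the parity of \<open>n\<close>.\<close>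

lemma foldr_alternating_simple_root:
  assumes diag: "m s s = 1" "m t t = 1"
    and form: "coxeter_form m (simple_root s) (simple_root t) = - c"
      "coxeter_form m (simple_root t) (simple_root s) = - c"
    and a: "a 0 = 0" "a 1 = 1" "\<And>n. a (Suc (Suc n)) = 2 * c * a (Suc n) - a n"
  shows "foldr (simple_reflection m) (alternating s t n) (simple_root s) =
    a n *\<^sub>R simple_root (if even n then t else s) + a (Suc n) *\<^sub>R simple_root (if even n then s else t)"
proof (induction n)
  case 0
  then show ?case using a by simp
next
  case (Suc n)
  let ?x = "if even n then t else s" and ?y = "if even n then s else t"
  have "simple_reflection m ?x (simple_root ?x) = - simple_root ?x"
    using diag by (simp add: simple_reflection_simple_root_self)
  moreover have "simple_reflection m ?x (simple_root ?y) = simple_root ?y + (2 * c) *\<^sub>R simple_root ?x"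
    using form by (simp add: simple_reflection_def)
  moreover note Suc.IH
  ultimately have "foldr (simple_reflection m) (alternating s t (Suc n)) (simple_root s) =
      a n *\<^sub>R (- simple_root ?x) + a (Suc n) *\<^sub>R (simple_root ?y + (2 * c) *\<^sub>R simple_root ?x)"
    by (simp only: alternating.simps foldr.simps o_apply linear_add[OF linear_simple_reflection]
        linear_scale[OF linear_simple_reflection])
  also have "\<dots> = a (Suc n) *\<^sub>R simple_root ?y + a (Suc (Suc n)) *\<^sub>R simple_root ?x"
    by (simp add: a(3) algebra_simps)
  finally show ?case by simp
qed

text \<open>
  The two simple roots span a plane on which the form is nondegenerate, so every vector is the sum
  of a vector in this plane and one that is fixed by both reflections.
\<close>

lemma foldr_relator:
  assumes diag: "m s s = 1" "m t t = 1" and sym: "m t s = m s t"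
    and off_diag: "s \<noteq> t \<Longrightarrow> m s t \<noteq> 1" and finite_order: "m s t \<noteq> 0"
  shows "foldr (simple_reflection m) (concat (replicate (m s t) [s, t])) v = v"
proof (cases "s = t")
  case True
  then show ?thesis using diag by (simp add: simple_reflection_involution)
next
  case False
  define k where "k = m s t"
  define c where "c = cos (pi / real k)"
  have k: "k \<ge> 2" using off_diag[OF False] finite_order by (auto simp: k_def)
  have form: "coxeter_form m (simple_root s) (simple_root t) = - c"
      "coxeter_form m (simple_root t) (simple_root s) = - c"
      "coxeter_form m (simple_root s) (simple_root s) = 1"
      "coxeter_form m (simple_root t) (simple_root t) = 1"
    using k diag sym by (auto simp: coxeter_form_simple_root c_def k_def)
  obtain a where a: "a 0 = 0" "a 1 = 1" "\<And>n. a (Suc (Suc n)) = 2 * c * a (Suc n) - a n"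
    and a2: "a (2 * k) = 0" "a (2 * k + 1) = 1" "a (2 * k - 1) = - 1"
    by (rule chebyshev_sequence[of k]) (use k that in \<open>simp_all add: c_def\<close>)
  let ?P = "foldr (simple_reflection m) (alternating s t (2 * k))"
  have P: "linear ?P" by (rule linear_foldr_simple_reflection)
  have Ps: "?P (simple_root s) = simple_root s"
    using foldr_alternating_simple_root[of m s t c a "2 * k"] diag form a a2 by simp
  \<comment> \<open>The last letter \<open>t\<close> negates its root. What remains is an
    alternating word of odd length \<open>2 * k - 1\<close> ending in \<open>s\<close>, so the
    formula applies with \<open>s\<close> and \<open>t\<close> exchanged, and
    \<open>a (2 * k - 1) = - 1\<close> restores the sign.\<close>
  have Pt: "?P (simple_root t) = simple_root t"
  proof -
    obtain j where j: "2 * k = Suc j" "odd j" using k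
      by (metis Suc_pred' even_Suc dvd_triv_left less_le_trans mult_pos_pos pos2)
    have "?P (simple_root t) = - foldr (simple_reflection m) (alternating t s j) (simple_root t)"
      by (simp only: j alternating_snoc foldr_append foldr.simps o_apply id_apply
          simple_reflection_simple_root_self[of m t, OF diag(2)]
          linear_neg[OF linear_foldr_simple_reflection])
    also have "\<dots> = simple_root t"
      using foldr_alternating_simple_root[of m t s c a j] diag form a a2 j
      by simp
    finally show ?thesis .
  qed
  \<comment> \<open>\<open>1 - c\<^sup>2\<close> is the Gram determinant of the two simple roots; it
    is nonzero because \<open>pi / k\<close> lies strictly between 0 and \<open>pi\<close>.\<close>
  have "cos (pi / real k) < cos 0" "cos pi < cos (pi / real k)"
    using k by (intro cos_monotone_0_pi; simp add: field_simps)+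
  then have c: "1 - c\<^sup>2 \<noteq> 0"
    unfolding c_def by (metis abs_square_less_1 abs_less_iff cos_pi cos_zero diff_gt_0_iff_gt less_irrefl minus_less_iff)
  define p q where "p = coxeter_form m (simple_root s) v" and "q = coxeter_form m (simple_root t) v"
  \<comment> \<open>Cramer's rule for the system \<open>x - c * y = p\<close>,
    \<open>y - c * x = q\<close>, which says that \<open>u\<close> is orthogonal to both simple
    roots.\<close>
  define x y where "x = (p + c * q) / (1 - c\<^sup>2)" and "y = (q + c * p) / (1 - c\<^sup>2)"
  define u where "u = v - x *\<^sub>R simple_root s - y *\<^sub>R simple_root t"
  have "x - c * y = p" "y - c * x = q"
  proof -
    have "x - c * y = (p * (1 - c\<^sup>2)) / (1 - c\<^sup>2)" "y - c * x = (q * (1 - c\<^sup>2)) / (1 - c\<^sup>2)"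
      by (simp_all add: x_def y_def algebra_simps power2_eq_square flip: diff_divide_distrib)
    with c show "x - c * y = p" "y - c * x = q" by simp_all
  qed
  then have "coxeter_form m (simple_root s) u = 0" "coxeter_form m (simple_root t) u = 0"
    by (auto simp: u_def coxeter_form_simps form p_def[symmetric] q_def[symmetric] algebra_simps)
  then have fixed: "simple_reflection m s u = u" "simple_reflection m t u = u"
    by (simp_all add: simple_reflection_def)
  have "foldr (simple_reflection m) (alternating s t n) u = u" for n
    by (induction n) (auto simp: fixed)
  moreover have "v = u + x *\<^sub>R simple_root s + y *\<^sub>R simple_root t"
    by (simp add: u_def)
  ultimately have "?P v = v"
    by (metis (no_types, lifting) P Ps Pt linear_add linear_scale)
  then show ?thesis by (simp add: concat_replicate_eq_alternating k_def)
qed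

section \<open>The group acting on roots\<close>

context coxeter_system
begin

lemma generator_closed [simp, intro]: "s \<in> S \<Longrightarrow> s \<in> carrier G"
  using generators_closed by auto

lemma word_prod_Nil [simp]: "word_prod [] = \<one>"
  by (simp add: word_prod_def)

lemma word_prod_Cons [simp]: "word_prod (s # ws) = s \<otimes> word_prod ws"
  by (simp add: word_prod_def)

lemma word_prod_closed [simp, intro]: "ws \<in> lists S \<Longrightarrow> word_prod ws \<in> carrier G"
  by (induction ws) auto

lemma word_prod_append:
  "us \<in> lists S \<Longrightarrow> vs \<in> lists S \<Longrightarrow> word_prod (us @ vs) = word_prod us \<otimes> word_prod vs"
  by (induction us) (auto simp: m_assoc)

lemma word_prod_relator:
  assumes "s \<in> S" "t \<in> S" "m s t \<noteq> 0"
  shows "word_prod (concat (replicate (m s t) [s, t])) = \<one>"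
proof -
  have "insert_relator S m ([] @ []) ([] @ concat (replicate (m s t) [s, t]) @ [])"
    using assms by (intro insert_relator.intros) auto
  then have "equivclp (insert_relator S m) [] (concat (replicate (m s t) [s, t]))"
    by auto
  moreover have "concat (replicate (m s t) [s, t]) \<in> lists S"
    using assms by auto
  ultimately show ?thesis
    using presentation[of "[]" "concat (replicate (m s t) [s, t])"] by simp
qed

lemma generator_square [simp]: "s \<in> S \<Longrightarrow> s \<otimes> s = \<one>"
  using word_prod_relator[of s s] matrix_diag[of s] by auto

lemma mult_generator_twice [simp]: "g \<in> carrier G \<Longrightarrow> s \<in> S \<Longrightarrow> g \<otimes> s \<otimes> s = g"
  by (simp add: m_assoc)

lemma generator_mult_twice [simp]: "g \<in> carrier G \<Longrightarrow> s \<in> S \<Longrightarrow> s \<otimes> (s \<otimes> g) = g"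
  by (simp flip: m_assoc)

lemma ex_word:
  assumes "g \<in> carrier G"
  shows "\<exists>ws\<in>lists S. word_prod ws = g"
proof -
  have "g \<in> generate G S" using assms generated by simp
  then show ?thesis
  proof (induction rule: generate.induct)
    case one
    show ?case by (intro bexI[of _ "[]"]) auto
  next
    case (incl h)
    then show ?case by (intro bexI[of _ "[h]"]) auto
  next
    case (inv h)
    then have "inv h = h" by (intro inv_equality) auto
    with inv show ?case by (intro bexI[of _ "[h]"]) auto
  next
    case (eng g h)
    then show ?case by (metis append_in_lists_conv word_prod_append)
  qed
qed

section \<open>Word length, descents and the braid relation\<close>

definition len :: "'a \<Rightarrow> nat" where
  "len g = (LEAST n. \<exists>ws\<in>lists S. word_prod ws = g \<and> length ws = n)"

lemma ex_reduced_word: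
  assumes "g \<in> carrier G"
  obtains ws where "ws \<in> lists S" "word_prod ws = g" "length ws = len g"
proof -
  have "\<exists>n. \<exists>ws\<in>lists S. word_prod ws = g \<and> length ws = n"
    using ex_word[OF assms] by blast
  from LeastI_ex[OF this] show ?thesis
    using that unfolding len_def by blast
qed

lemma len_word_prod_le: "ws \<in> lists S \<Longrightarrow> len (word_prod ws) \<le> length ws"
  unfolding len_def by (rule Least_le) blast

lemma len_mult_word_prod_le:
  assumes "g \<in> carrier G" "ws \<in> lists S"
  shows "len (g \<otimes> word_prod ws) \<le> len g + length ws"
proof -
  obtain us where "us \<in> lists S" "word_prod us = g" "length us = len g"
    using ex_reduced_word[OF assms(1)] .
  then show ?thesis
    using len_word_prod_le[of "us @ ws"] assms by (simp add: word_prod_append)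
qed

text \<open>The last letter of a reduced word is a descent. Deleting it lowers the length by exactly
  one, since multiplying it back adds at most one.\<close>

lemma ex_descent:
  assumes "g \<in> carrier G" "g \<noteq> \<one>"
  obtains t where "t \<in> S" "Suc (len (g \<otimes> t)) = len g"
proof -
  obtain ws where ws: "ws \<in> lists S" "word_prod ws = g" "length ws = len g"
    using ex_reduced_word[OF assms(1)] .
  with assms have "ws \<noteq> []" by auto
  then obtain us t where us: "ws = us @ [t]" by (metis rev_exhaust)
  then have t: "t \<in> S" "us \<in> lists S" using ws by auto
  then have "g = word_prod us \<otimes> t" using ws us by (auto simp: word_prod_append)
  with t have "g \<otimes> t = word_prod us" by simp
  then have "Suc (len (g \<otimes> t)) \<le> len g"
    using len_word_prod_le[OF t(2)] ws us by simp
  moreover have "len g \<le> Suc (len (g \<otimes> t))"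
    using len_mult_word_prod_le[of "g \<otimes> t" "[t]"] t assms by simp
  ultimately show ?thesis using that t by simp
qed

text \<open>The braid relation, obtained by moving half of the letters of the relator to the other
  side.\<close>

lemma word_prod_alternating_swap:
  assumes st: "s \<in> S" "t \<in> S" "m s t \<noteq> 0"
  shows "word_prod (alternating s t (m s t)) = word_prod (alternating t s (m s t))"
proof -
  \<comment> \<open>Generators are involutions, so the first \<open>k\<close> letters of the
    relator, moved across one by one, reappear in reversed order. The braid relation is the case
    \<open>k = m s t\<close>.\<close>
  have "word_prod (alternating s t (2 * m s t - k)) = word_prod (alternating t s k)"
    if "k \<le> 2 * m s t" for k
    using that
  proof (induction k)
    case 0
    show ?case
      using word_prod_relator[OF st] by (simp add: concat_replicate_eq_alternating)
  next
    case (Suc k)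
    define x where "x = (if even k then s else t)"
    have x: "x \<in> S" using st by (simp add: x_def)
    define j where "j = 2 * m s t - Suc k"
    have j: "2 * m s t - k = Suc j" "even j \<longleftrightarrow> odd k"
      using Suc.prems unfolding j_def by (linarith, simp)
    have closed: "word_prod (alternating s t j) \<in> carrier G"
      by (intro word_prod_closed alternating_in_lists st)
    have "x \<otimes> word_prod (alternating s t j) = word_prod (alternating s t (Suc j))"
      using j by (simp add: x_def)
    also have "\<dots> = word_prod (alternating t s k)"
      using Suc by (simp flip: j)
    finally have "word_prod (alternating s t j) = x \<otimes> word_prod (alternating t s k)"
      using x closed by (metis generator_mult_twice)
    then show ?case by (simp add: x_def j_def)
  qed
  from this[of "m s t"] show ?thesis by simp
qed

section \<open>The action on the geometric representation\<close>

definition act :: "'a \<Rightarrow> ('a \<Rightarrow>\<^sub>0 real) \<Rightarrow> ('a \<Rightarrow>\<^sub>0 real)" where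
  "act g = foldr (simple_reflection m) (SOME ws. ws \<in> lists S \<and> word_prod ws = g)"

lemma foldr_cong_relator:
  assumes "insert_relator S m us vs"
  shows "foldr (simple_reflection m) us v = foldr (simple_reflection m) vs v"
  using assms
proof cases
  case (1 us' vs' s t)
  have "foldr (simple_reflection m) (concat (replicate (m s t) [s, t])) w = w" for w
    using 1 matrix_diag matrix_sym matrix_off_diag by (intro foldr_relator) auto
  then show ?thesis using 1 by simp
qed

text \<open>The chosen word does not matter: two words for one element are linked by insertions and
  deletions of relators, and relators act trivially.\<close>

lemma act_word_prod:
  assumes "ws \<in> lists S"
  shows "act (word_prod ws) = foldr (simple_reflection m) ws"
proof -
  define us where "us = (SOME us. us \<in> lists S \<and> word_prod us = word_prod ws)"
  have us: "us \<in> lists S \<and> word_prod us = word_prod ws"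
    unfolding us_def by (rule someI[of _ ws]) (use assms in simp)
  then have "equivclp (insert_relator S m) us ws"
    using presentation assms by blast
  then have "foldr (simple_reflection m) us v = foldr (simple_reflection m) ws v" for v
    by (induction rule: equivclp_induct) (metis foldr_cong_relator)+
  then show ?thesis by (auto simp: act_def us_def[symmetric])
qed

lemma act_one [simp]: "act \<one> v = v"
  using act_word_prod[of "[]"] by simp

lemma act_generator: "s \<in> S \<Longrightarrow> act s = simple_reflection m s"
  using act_word_prod[of "[s]"] by (auto simp: o_def)

lemma act_mult:
  assumes "g \<in> carrier G" "h \<in> carrier G"
  shows "act (g \<otimes> h) v = act g (act h v)"
proof -
  obtain us vs where "us \<in> lists S" "word_prod us = g" "vs \<in> lists S" "word_prod vs = h"
    using ex_word assms by metis
  then show ?thesis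
    using act_word_prod[of "us @ vs"] act_word_prod[of us] act_word_prod[of vs]
    by (simp add: word_prod_append)
qed

lemma linear_act: "linear (act g)"
  unfolding act_def by (rule linear_foldr_simple_reflection)

lemma keys_act: "g \<in> carrier G \<Longrightarrow> Poly_Mapping.keys v \<subseteq> S \<Longrightarrow> Poly_Mapping.keys (act g v) \<subseteq> S"
  by (metis act_word_prod ex_word keys_foldr_simple_reflection)

lemma act_inv_act [simp]: "g \<in> carrier G \<Longrightarrow> act (inv g) (act g v) = v"
  by (simp flip: act_mult)

lemma act_eq_iff: "g \<in> carrier G \<Longrightarrow> act g u = act g v \<longleftrightarrow> u = v"
  by (metis act_inv_act)

lemma act_generator_simple_root: "s \<in> S \<Longrightarrow> act s (simple_root s) = - simple_root s"
  by (simp add: act_generator simple_reflection_simple_root_self matrix_diag)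

text \<open>
  \<open>g\<close> is factored as \<open>v\<close> times an alternating word ending in a right descent \<open>t\<close> of \<open>g\<close>,
  with the alternating factor as long as possible. Then \<open>v\<close> has neither \<open>s\<close> nor \<open>t\<close> as a right
  descent, so the induction hypothesis applies to both simple roots of the dihedral factor.
\<close>

lemma act_simple_root_nonneg:
  assumes "g \<in> carrier G" "s \<in> S" "len g \<le> len (g \<otimes> s)"
  shows "0 \<le> Poly_Mapping.lookup (act g (simple_root s)) i"
  using assms
proof (induction "len g" arbitrary: g s i rule: less_induct)
  case less
  note g = less.prems(1) and s = less.prems(2)
  show ?case
  proof (cases "g = \<one>")
    case True
    then show ?thesis by (simp add: lookup_simple_root)
  next
    case False
    obtain t where t: "t \<in> S" "Suc (len (g \<otimes> t)) = len g"
      using ex_descent[OF g False] .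
    then have "s \<noteq> t" using less.prems(3) by auto
    then have mst: "m s t \<noteq> 1" using matrix_off_diag s t by blast
    let ?alt = "\<lambda>n. word_prod (alternating s t n)"
    have alt: "alternating s t n \<in> lists S" for n
      using s t by (simp add: alternating_in_lists)
    \<comment> \<open>As the lengths add up, \<open>k\<close> is at most \<open>len g\<close>, so
      there is a largest \<open>k\<close>; the descent \<open>t\<close> gives
      \<open>P 1\<close>.\<close>
    define P where "P k \<longleftrightarrow> (m s t = 0 \<or> k \<le> m s t) \<and>
      (\<exists>v\<in>carrier G. g = v \<otimes> ?alt k \<and> len g = len v + k)" for k
    have "P 1"
      unfolding P_def using g t mst by (auto intro!: bexI[of _ "g \<otimes> t"])
    moreover have bound: "k \<le> len g" if "P k" for k using that by (auto simp: P_def)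
    ultimately obtain k where k: "P k" "\<And>j. P j \<Longrightarrow> j \<le> k" "1 \<le> k"
      by (metis GreatestI_nat Greatest_le_nat)
    then obtain v where v: "v \<in> carrier G" "g = v \<otimes> ?alt k" "len g = len v + k"
      by (auto simp: P_def)
    obtain j where j: "k = Suc j" using k(3) by (cases k) auto
    have len_le: "len g \<le> len u + n" if "g = u \<otimes> ?alt n" "u \<in> carrier G" for u n
      using len_mult_word_prod_le[OF that(2) alt[of n]] that by simp
    \<comment> \<open>If \<open>k\<close> were \<open>m s t\<close>, the braid relation would make
      the alternating factor end in \<open>s\<close>, and \<open>s\<close> would be a descent of
      \<open>g\<close>. The strict bound is there for the coefficient \<open>a (Suc k)\<close>
      below.\<close>
    have range: "m s t = 0 \<or> Suc k \<le> m s t"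
    proof (rule ccontr)
      assume "\<not> ?thesis"
      then have km: "m s t \<noteq> 0" "m s t = Suc j" using k j by (auto simp: P_def)
      have "g = v \<otimes> word_prod (alternating t s (Suc j))"
        using word_prod_alternating_swap[OF s t(1)] v(2) km j by metis
      also have "\<dots> = v \<otimes> ?alt j \<otimes> s"
        using alt[of j] s v by (simp only: alternating_snoc) (simp add: word_prod_append m_assoc)
      finally have "g \<otimes> s = v \<otimes> ?alt j"
        using alt[of j] s v by simp
      then have "len (g \<otimes> s) \<le> len v + j"
        using len_mult_word_prod_le[OF v(1) alt[of j]] by simp
      then show False using less.prems(3) v j by simp
    qed
    \<comment> \<open>\<open>x\<close> is the letter that would extend the alternating factor on the
      left, \<open>y\<close> is its first letter. If \<open>x\<close> shortened \<open>v\<close>,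
      then \<open>P (Suc k)\<close> would hold; if \<open>y\<close> did, cancelling it would make
      \<open>g\<close> shorter than \<open>len v + k\<close>.\<close>
    define x where "x = (if even k then t else s)"
    define y where "y = (if even k then s else t)"
    have xy: "x \<in> S" "y \<in> S" using s t by (auto simp: x_def y_def)
    have "len v \<le> len (v \<otimes> x)"
    proof (rule ccontr)
      assume shorter: "\<not> ?thesis"
      have "g = v \<otimes> x \<otimes> ?alt (Suc k)"
        using v xy alt[of k] by (simp add: x_def[symmetric] m_assoc)
      moreover from this have "len g = len (v \<otimes> x) + Suc k"
        using len_le[of "v \<otimes> x" "Suc k"] shorter v xy by simp
      ultimately have "P (Suc k)"
        unfolding P_def using range v xy by blast
      then show False using k(2) by fastforce
    qed
    then have x_nonneg: "0 \<le> Poly_Mapping.lookup (act v (simple_root x)) i"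
      using less.hyps v xy k(3) by simp
    have "len v \<le> len (v \<otimes> y)"
    proof (rule ccontr)
      assume shorter: "\<not> ?thesis"
      have "g = v \<otimes> (y \<otimes> ?alt j)"
        using v(2) by (simp add: j y_def if_distrib)
      then have "g = v \<otimes> y \<otimes> ?alt j"
        using v xy alt[of j] by (simp add: m_assoc)
      then show False
        using len_le[of "v \<otimes> y" j] shorter v xy j by simp
    qed
    then have y_nonneg: "0 \<le> Poly_Mapping.lookup (act v (simple_root y)) i"
      using less.hyps v xy k(3) by simp
    define c where "c = (if m s t = 0 then 1 else cos (pi / real (m s t)))"
    obtain a where a: "a 0 = 0" "a 1 = 1" "\<And>n. a (Suc (Suc n)) = 2 * c * a (Suc n) - a n"
      and a_nonneg: "\<And>n. m s t = 0 \<or> n \<le> m s t \<Longrightarrow> 0 \<le> a n"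
      by (rule chebyshev_sequence[OF mst]) (use that in \<open>simp_all add: c_def\<close>)
    have "act (?alt k) (simple_root s) = a k *\<^sub>R simple_root x + a (Suc k) *\<^sub>R simple_root y"
      using foldr_alternating_simple_root[of m s t c a k] a matrix_diag s t matrix_sym[OF s t(1)]
      by (simp add: act_word_prod[OF alt] x_def y_def coxeter_form_simple_root c_def)
    then have "act g (simple_root s) = a k *\<^sub>R act v (simple_root x) + a (Suc k) *\<^sub>R act v (simple_root y)"
      using v alt[of k]
      by (simp add: act_mult linear_add[OF linear_act] linear_scale[OF linear_act])
    moreover have "0 \<le> a k" "0 \<le> a (Suc k)"
      using a_nonneg range by auto
    ultimately show ?thesis
      using x_nonneg y_nonneg by (simp add: lookup_add)
  qed
qed

text \<open>For a simple reflection, the cross terms cancel against the square term because simple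
  roots have norm 1. It follows that all roots have norm 1.\<close>

lemma coxeter_form_act:
  assumes "g \<in> carrier G" "Poly_Mapping.keys v \<subseteq> S"
  shows "coxeter_form m (act g v) (act g v) = coxeter_form m v v"
proof -
  have "ws \<in> lists S \<Longrightarrow> coxeter_form m (foldr (simple_reflection m) ws v)
      (foldr (simple_reflection m) ws v) = coxeter_form m v v" for ws
  proof (induction ws)
    case (Cons s ws)
    let ?u = "foldr (simple_reflection m) ws v"
    have sws: "s \<in> S" "ws \<in> lists S" using Cons.prems by auto
    have "Poly_Mapping.keys ?u \<subseteq> S" "Poly_Mapping.keys (simple_root s) \<subseteq> S"
      using sws keys_foldr_simple_reflection[OF sws(2) assms(2)] by (simp_all add: keys_simple_root)
    then have "coxeter_form m ?u (simple_root s) = coxeter_form m (simple_root s) ?u"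
      by (intro coxeter_form_commute[of S]) (auto simp: matrix_sym)
    moreover have "coxeter_form m (simple_root s) (simple_root s) = 1"
      using sws by (simp add: coxeter_form_simple_root matrix_diag)
    ultimately have "coxeter_form m (simple_reflection m s ?u) (simple_reflection m s ?u)
        = coxeter_form m ?u ?u"
      by (simp add: simple_reflection_def coxeter_form_simps algebra_simps)
    with Cons.IH sws show ?case by simp
  qed simp
  then show ?thesis
    using ex_word[OF assms(1)] act_word_prod by metis
qed

section \<open>Roots and their signs\<close>

lemma roots_eq: "roots S m = {act g (simple_root s) | g s. g \<in> carrier G \<and> s \<in> S}"
proof (intro equalityI subsetI)
  fix \<beta> assume "\<beta> \<in> roots S m"
  then obtain ws s where "ws \<in> lists S" "s \<in> S"
    "\<beta> = foldr (simple_reflection m) ws (simple_root s)"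
    unfolding roots_def by blast
  then show "\<beta> \<in> {act g (simple_root s) | g s. g \<in> carrier G \<and> s \<in> S}"
    using act_word_prod[of ws] word_prod_closed[of ws] by (metis (mono_tags, lifting) mem_Collect_eq)
next
  fix \<beta> assume "\<beta> \<in> {act g (simple_root s) | g s. g \<in> carrier G \<and> s \<in> S}"
  then obtain g s where gs: "g \<in> carrier G" "s \<in> S" "\<beta> = act g (simple_root s)"
    by blast
  then obtain ws where "ws \<in> lists S" "word_prod ws = g" using ex_word by blast
  then show "\<beta> \<in> roots S m"
    unfolding roots_def using act_word_prod[of ws] gs by auto
qed

lemma act_roots:
  assumes "g \<in> carrier G" "\<beta> \<in> roots S m"
  shows "act g \<beta> \<in> roots S m"
proof -
  obtain h s where "h \<in> carrier G" "s \<in> S" "\<beta> = act h (simple_root s)"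
    using assms(2) by (auto simp: roots_eq)
  then show ?thesis
    using assms(1) by (auto simp: roots_eq simp flip: act_mult)
qed

lemma simple_root_in_roots: "s \<in> S \<Longrightarrow> simple_root s \<in> roots S m"
  unfolding roots_def by (intro CollectI exI[of _ "[]"] exI[of _ s]) simp

lemma uminus_roots:
  assumes "\<beta> \<in> roots S m"
  shows "- \<beta> \<in> roots S m"
proof -
  obtain g s where gs: "g \<in> carrier G" "s \<in> S" "\<beta> = act g (simple_root s)"
    using assms by (auto simp: roots_eq)
  then have "- \<beta> = act g (act s (simple_root s))"
    by (simp add: act_generator_simple_root linear_neg[OF linear_act])
  with gs show ?thesis
    by (simp add: act_roots simple_root_in_roots)
qed

lemma keys_root: "\<beta> \<in> roots S m \<Longrightarrow> Poly_Mapping.keys \<beta> \<subseteq> S"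
  unfolding roots_eq
proof clarify
  fix g s i assume "g \<in> carrier G" "s \<in> S" "i \<in> Poly_Mapping.keys (act g (simple_root s))"
  then show "i \<in> S"
    using keys_act[of g "simple_root s"] by (auto simp: keys_simple_root)
qed

lemma coxeter_form_root: "\<beta> \<in> roots S m \<Longrightarrow> coxeter_form m \<beta> \<beta> = 1"
  unfolding roots_eq
  by (auto simp: coxeter_form_act keys_simple_root coxeter_form_simple_root matrix_diag)

lemma root_nonzero: "\<beta> \<in> roots S m \<Longrightarrow> \<beta> \<noteq> 0"
  using coxeter_form_root[of \<beta>] by (auto simp: coxeter_form_def)

text \<open>Write the root as the image of a simple root under \<open>g\<close>. If
  \<open>g \<otimes> s\<close> is shorter than \<open>g\<close>, then
  \<open>act_simple_root_nonneg\<close> applies to \<open>g \<otimes> s\<close>, which sends the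
  simple root to the negative of the given root.\<close>

lemma root_sign:
  assumes "\<beta> \<in> roots S m"
  shows "nonneg \<beta> \<or> nonneg (- \<beta>)"
proof -
  obtain g s where gs: "g \<in> carrier G" "s \<in> S" "\<beta> = act g (simple_root s)"
    using assms by (auto simp: roots_eq)
  have "nonneg \<beta>" if "len g \<le> len (g \<otimes> s)"
    using gs act_simple_root_nonneg that by (simp add: nonneg_def)
  moreover have "nonneg (- \<beta>)" if "\<not> len g \<le> len (g \<otimes> s)"
  proof -
    have "- \<beta> = act (g \<otimes> s) (simple_root s)"
      using gs by (simp add: act_mult act_generator_simple_root linear_neg[OF linear_act])
    then show ?thesis
      using gs act_simple_root_nonneg[of "g \<otimes> s" s] that by (simp add: nonneg_def)
  qed
  ultimately show ?thesis by blast
qed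

lemma positive_roots_iff: "\<beta> \<in> positive_roots S m \<longleftrightarrow> \<beta> \<in> roots S m \<and> nonneg \<beta>"
proof -
  have "0 \<le> Poly_Mapping.lookup \<beta> i"
    if "\<beta> \<in> roots S m" "\<forall>s\<in>S. 0 \<le> Poly_Mapping.lookup \<beta> s" for i
    using keys_root[OF that(1)] that(2)
    by (metis in_keys_iff order_refl subsetD)
  then show ?thesis by (auto simp: positive_roots_def nonneg_def)
qed

lemma simple_root_positive: "s \<in> S \<Longrightarrow> simple_root s \<in> positive_roots S m"
  by (simp add: positive_roots_iff simple_root_in_roots nonneg_def lookup_simple_root)

text \<open>The reflection changes only the coordinate at \<open>s\<close>. If the image were
  negative, all other coordinates of \<beta> would vanish, and norm 1 would force \<beta> to be the
  simple root itself. The second conclusion later makes \<tau> an involution.\<close>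

lemma act_generator_positive_root:
  assumes s: "s \<in> S" and \<beta>: "\<beta> \<in> positive_roots S m" "\<beta> \<noteq> simple_root s"
  shows "act s \<beta> \<in> positive_roots S m" "act s \<beta> \<noteq> simple_root s"
proof -
  have root: "\<beta> \<in> roots S m" "nonneg \<beta>" using \<beta> by (auto simp: positive_roots_iff)
  have "\<not> nonneg (- act s \<beta>)"
  proof
    assume neg: "nonneg (- act s \<beta>)"
    define b where "b = Poly_Mapping.lookup \<beta> s"
    have "Poly_Mapping.lookup \<beta> t = 0" if "t \<noteq> s" for t
    proof -
      have "Poly_Mapping.lookup (act s \<beta>) t = Poly_Mapping.lookup \<beta> t"
        using s that by (simp add: act_generator lookup_simple_reflection)
      then show ?thesis
        using neg root(2) by (metis nonneg_def lookup_uminus neg_0_le_iff_le order_antisym)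
    qed
    then have \<beta>_eq: "\<beta> = b *\<^sub>R simple_root s"
      by (intro poly_mapping_eqI) (auto simp: lookup_simple_root b_def)
    have "b * b = 1"
      using coxeter_form_root[OF root(1)] s
      by (simp add: \<beta>_eq coxeter_form_simps coxeter_form_simple_root matrix_diag)
    moreover have "0 \<le> b" using root(2) by (simp add: b_def nonneg_def)
    ultimately have "b = 1"
      by (metis abs_of_nonneg abs_1 real_sqrt_abs2 real_sqrt_one)
    then show False using \<beta>_eq \<beta>(2) by simp
  qed
  then show "act s \<beta> \<in> positive_roots S m"
    using root_sign[OF act_roots[of s \<beta>]] s root act_roots[of s \<beta>]
    by (auto simp: positive_roots_iff)
  show "act s \<beta> \<noteq> simple_root s"
  proof
    assume "act s \<beta> = simple_root s"
    then have "act s \<beta> = act s (- simple_root s)"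
      using s by (simp add: act_generator_simple_root linear_neg[OF linear_act])
    then have "\<beta> = - simple_root s" using s by (simp add: act_eq_iff)
    with root show False
      using nonneg_antisym[of "simple_root s"] simple_root_positive[OF s] simple_root_nonzero[of s]
      by (auto simp: positive_roots_iff)
  qed
qed

section \<open>The coloring of a group element\<close>

definition coloring :: "'a \<Rightarrow> ('a \<Rightarrow>\<^sub>0 real) \<Rightarrow> nat" where
  "coloring g = (\<lambda>\<beta>\<in>positive_roots S m. if nonneg (act g \<beta>) then 1 else 2)"

lemma nonneg_act_uminus_iff:
  assumes "g \<in> carrier G" "\<beta> \<in> roots S m"
  shows "nonneg (act g (- \<beta>)) \<longleftrightarrow> \<not> nonneg (act g \<beta>)"
  using root_sign[OF act_roots[OF assms]] root_nonzero[OF act_roots[OF assms]]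
    nonneg_antisym[of "act g \<beta>"]
  by (auto simp: linear_neg[OF linear_act])

text \<open>A descent \<open>t\<close> of \<open>g \<otimes> inv h\<close> yields the root \<gamma>,
  the image of the simple root of \<open>t\<close> under \<open>inv h\<close>: it is positive after
  \<open>h\<close> and negative after \<open>g\<close>. One of \<gamma> and its negative is a
  positive root, and there the two colorings differ.\<close>

lemma inj_on_coloring: "inj_on coloring (carrier G)"
proof (rule inj_onI, rule ccontr)
  fix g h assume gh: "g \<in> carrier G" "h \<in> carrier G" "coloring g = coloring h" "g \<noteq> h"
  define u where "u = g \<otimes> inv h"
  have u: "u \<in> carrier G" "u \<otimes> h = g" using gh by (auto simp: u_def m_assoc)
  then have "u \<noteq> \<one>" using gh by auto
  then obtain t where t: "t \<in> S" "Suc (len (u \<otimes> t)) = len u"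
    using ex_descent u(1) by metis
  have "nonneg (act (u \<otimes> t) (simple_root t))"
    using act_simple_root_nonneg[of "u \<otimes> t" t] t u by (simp add: nonneg_def)
  then have "nonneg (act u (- simple_root t))"
    using t u by (simp add: act_mult act_generator_simple_root)
  then have neg: "\<not> nonneg (act u (simple_root t))"
    using nonneg_act_uminus_iff u t simple_root_in_roots by blast
  define \<gamma> where "\<gamma> = act (inv h) (simple_root t)"
  have \<gamma>: "\<gamma> \<in> roots S m" using gh t by (simp add: \<gamma>_def act_roots simple_root_in_roots)
  have h\<gamma>: "act h \<gamma> = simple_root t" using gh by (simp add: \<gamma>_def flip: act_mult)
  have g\<gamma>: "act g \<gamma> = act u (simple_root t)"
    using u gh h\<gamma> by (metis act_mult)
  have eq: "nonneg (act g \<beta>) = nonneg (act h \<beta>)" if "\<beta> \<in> positive_roots S m" for \<beta>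
    using fun_cong[OF gh(3), of \<beta>] that by (auto simp: coloring_def split: if_splits)
  have "nonneg (act h \<gamma>)"
    using h\<gamma> simple_root_positive[OF t(1)] by (simp add: positive_roots_iff)
  moreover have "\<not> nonneg (act g \<gamma>)" using neg g\<gamma> by simp
  ultimately show False
    using eq[of \<gamma>] eq[of "- \<gamma>"] root_sign[OF \<gamma>] \<gamma> gh
    by (auto simp: positive_roots_iff uminus_roots nonneg_act_uminus_iff)
qed

context
  assumes finite_group: "finite (carrier G)"
begin

lemma finite_generators: "finite S"
  using finite_group generators_closed finite_subset by blast

lemma finite_positive_roots: "finite (positive_roots S m)"
proof (rule finite_subset)
  show "positive_roots S m \<subseteq> (\<lambda>(g, s). act g (simple_root s)) ` (carrier G \<times> S)"
    by (auto simp: positive_roots_iff roots_eq)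
qed (simp add: finite_group finite_generators)

text \<open>Positive roots are nonzero with nonnegative coordinates, so the pointedness required by
  the sign vector criterion holds.\<close>

lemma transitive_2_colorings_positive_roots:
  "\<epsilon> \<in> transitive_2_colorings (positive_roots S m) \<longleftrightarrow> \<epsilon> \<in> positive_roots S m \<rightarrow>\<^sub>E {1, 2} \<and>
    (\<forall>c. (\<forall>\<beta>\<in>positive_roots S m. (0::real) \<le> c \<beta>)
        \<and> (\<Sum>\<beta>\<in>positive_roots S m. (c \<beta> * (if \<epsilon> \<beta> = 1 then 1 else - 1)) *\<^sub>R \<beta>) = 0
      \<longrightarrow> (\<forall>\<beta>\<in>positive_roots S m. c \<beta> = 0))"
proof -
  have pointed: "\<forall>\<beta>\<in>positive_roots S m. c \<beta> = 0"
    if "\<And>\<beta>. \<beta> \<in> positive_roots S m \<Longrightarrow> (0::real) \<le> c \<beta>"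
      "(\<Sum>\<beta>\<in>positive_roots S m. c \<beta> *\<^sub>R \<beta>) = 0" for c
    by (rule nonneg_combination_eq_0[OF finite_positive_roots])
       (use that root_nonzero in \<open>auto simp: positive_roots_iff\<close>)
  show ?thesis
    unfolding transitive_2_colorings_def mem_Collect_eq
  proof (rule conj_cong[OF refl])
    assume "\<epsilon> \<in> positive_roots S m \<rightarrow>\<^sub>E {1, 2}"
    then have "\<epsilon> \<in> positive_roots S m \<rightarrow> {1, 2}" by auto
    from transitive_coloring_iff_signed_relation[OF finite_positive_roots pointed this]
    show "transitive_coloring (positive_roots S m) \<epsilon> \<longleftrightarrow> (\<forall>c. (\<forall>\<beta>\<in>positive_roots S m. (0::real) \<le> c \<beta>)
        \<and> (\<Sum>\<beta>\<in>positive_roots S m. (c \<beta> * (if \<epsilon> \<beta> = 1 then 1 else - 1)) *\<^sub>R \<beta>) = 0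
      \<longrightarrow> (\<forall>\<beta>\<in>positive_roots S m. c \<beta> = 0))"
      by blast
  qed
qed

text \<open>Multiplied by the sign of its color, the image of each positive root under
  \<open>g\<close> is nonnegative. So \<open>g\<close> turns a signed relation into a vanishing
  nonnegative combination of nonzero nonnegative vectors.\<close>

lemma coloring_transitive:
  assumes g: "g \<in> carrier G"
  shows "coloring g \<in> transitive_2_colorings (positive_roots S m)"
  unfolding transitive_2_colorings_positive_roots
proof (intro conjI allI impI)
  show "coloring g \<in> positive_roots S m \<rightarrow>\<^sub>E {1, 2}"
    by (auto simp: coloring_def)
next
  fix c :: "('a \<Rightarrow>\<^sub>0 real) \<Rightarrow> real"
  let ?\<sigma> = "\<lambda>\<beta>. if coloring g \<beta> = 1 then 1 else - 1 :: real"
  assume c: "(\<forall>\<beta>\<in>positive_roots S m. 0 \<le> c \<beta>) \<and>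
    (\<Sum>\<beta>\<in>positive_roots S m. (c \<beta> * ?\<sigma> \<beta>) *\<^sub>R \<beta>) = 0"
  show "\<forall>\<beta>\<in>positive_roots S m. c \<beta> = 0"
  proof (rule nonneg_combination_eq_0[OF finite_positive_roots])
    have "(\<Sum>\<beta>\<in>positive_roots S m. c \<beta> *\<^sub>R (?\<sigma> \<beta> *\<^sub>R act g \<beta>))
        = act g (\<Sum>\<beta>\<in>positive_roots S m. (c \<beta> * ?\<sigma> \<beta>) *\<^sub>R \<beta>)"
      by (simp add: linear_sum[OF linear_act] linear_scale[OF linear_act])
    also have "\<dots> = 0"
      using c by (simp add: linear_0[OF linear_act])
    finally show "(\<Sum>\<beta>\<in>positive_roots S m. c \<beta> *\<^sub>R (?\<sigma> \<beta> *\<^sub>R act g \<beta>)) = 0" .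
  next
    fix \<beta> assume \<beta>: "\<beta> \<in> positive_roots S m"
    then have root: "act g \<beta> \<in> roots S m" using g by (simp add: act_roots positive_roots_iff)
    show "nonneg (?\<sigma> \<beta> *\<^sub>R act g \<beta>)"
      using \<beta> root_sign[OF root] by (auto simp: coloring_def)
    show "?\<sigma> \<beta> *\<^sub>R act g \<beta> \<noteq> 0"
      using root_nonzero[OF root] by simp
  qed (use c in blast)
qed

section \<open>Every transitive coloring comes from a group element\<close>

lemma vector_eq_sum_simple_roots:
  assumes "Poly_Mapping.keys v \<subseteq> S"
  shows "v = (\<Sum>s\<in>S. Poly_Mapping.lookup v s *\<^sub>R simple_root s)"
proof (rule poly_mapping_eqI)
  fix t
  show "Poly_Mapping.lookup v t
    = Poly_Mapping.lookup (\<Sum>s\<in>S. Poly_Mapping.lookup v s *\<^sub>R simple_root s) t"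
    using assms finite_generators
    by (cases "t \<in> S") (auto simp: lookup_sum lookup_simple_root in_keys_iff if_distrib sum.delta cong: if_cong)
qed

lemma transitive_coloring_constant:
  assumes \<epsilon>: "\<epsilon> \<in> transitive_2_colorings (positive_roots S m)"
    and simple: "\<And>s. s \<in> S \<Longrightarrow> \<epsilon> (simple_root s) = 1"
    and \<beta>: "\<beta> \<in> positive_roots S m"
  shows "\<epsilon> \<beta> = 1"
proof (rule ccontr)
  assume not1: "\<epsilon> \<beta> \<noteq> 1"
  let ?E = "positive_roots S m"
  have \<beta>': "\<beta> \<in> roots S m" "nonneg \<beta>" using \<beta> by (auto simp: positive_roots_iff)
  \<comment> \<open>These are the coefficients of the relation between \<beta> and its expansion in
    simple roots: \<beta>, of color 2, enters with a minus sign, the simple roots with a plus sign.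
    The sum over \<open>S\<close> picks out the coordinate belonging to a simple root.\<close>
  define c where "c v = (if v = \<beta> then 1 else 0) +
    (\<Sum>s\<in>S. if v = simple_root s then Poly_Mapping.lookup \<beta> s else 0)" for v
  have c_nonneg: "0 \<le> (\<Sum>s\<in>S. if v = simple_root s then Poly_Mapping.lookup \<beta> s else 0)" for v
    using \<beta>' by (intro sum_nonneg) (auto simp: nonneg_def)
  have summand: "(c v * (if \<epsilon> v = 1 then 1 else - 1)) *\<^sub>R v = (if v = \<beta> then - \<beta> else 0) +
      (\<Sum>s\<in>S. if v = simple_root s then Poly_Mapping.lookup \<beta> s *\<^sub>R simple_root s else 0)" for v
  proof (cases "\<exists>s\<in>S. v = simple_root s")
    case True
    then have "\<epsilon> v = 1" "v \<noteq> \<beta>" using simple not1 by auto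
    then show ?thesis
      by (simp add: c_def scaleR_sum_left) (intro sum.cong; simp)
  next
    case False
    then have "(\<Sum>s\<in>S. if v = simple_root s then Poly_Mapping.lookup \<beta> s else 0) = 0"
      "(\<Sum>s\<in>S. if v = simple_root s then Poly_Mapping.lookup \<beta> s *\<^sub>R simple_root s else 0) = 0"
      by (auto intro!: sum.neutral)
    then show ?thesis using not1 by (simp add: c_def)
  qed
  have "(\<Sum>v\<in>?E. (c v * (if \<epsilon> v = 1 then 1 else - 1)) *\<^sub>R v)
      = (\<Sum>v\<in>?E. if v = \<beta> then - \<beta> else 0) +
        (\<Sum>s\<in>S. \<Sum>v\<in>?E. if v = simple_root s then Poly_Mapping.lookup \<beta> s *\<^sub>R simple_root s else 0)"
    unfolding summand by (subst sum.swap) (rule sum.distrib)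
  also have "\<dots> = - \<beta> + (\<Sum>s\<in>S. Poly_Mapping.lookup \<beta> s *\<^sub>R simple_root s)"
    using \<beta> finite_positive_roots simple_root_positive
    by (intro arg_cong2[of _ _ _ _ "(+)"] sum.cong) (auto simp: sum.delta)
  also have "\<dots> = 0"
    using vector_eq_sum_simple_roots[OF keys_root[OF \<beta>'(1)]] by simp
  finally have "(\<Sum>v\<in>?E. (c v * (if \<epsilon> v = 1 then 1 else - 1)) *\<^sub>R v) = 0" .
  moreover have "\<forall>v\<in>?E. 0 \<le> c v"
    using c_nonneg by (simp add: c_def)
  ultimately have "c \<beta> = 0"
    using \<epsilon>[unfolded transitive_2_colorings_positive_roots, THEN conjunct2, THEN spec, of c] \<beta>
    by blast
  then show False using c_nonneg[of \<beta>] by (simp add: c_def)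
qed

lemma ex_coloring_eq:
  assumes "\<epsilon> \<in> transitive_2_colorings (positive_roots S m)"
  shows "\<exists>g\<in>carrier G. \<epsilon> = coloring g"
  using assms
proof (induction "card {\<beta> \<in> positive_roots S m. \<epsilon> \<beta> = 2}" arbitrary: \<epsilon> rule: less_induct)
  case less
  let ?E = "positive_roots S m"
  have ext: "\<epsilon> \<in> ?E \<rightarrow>\<^sub>E {1, 2}"
    using less.prems by (simp add: transitive_2_colorings_def)
  show ?case
  proof (cases "\<forall>s\<in>S. \<epsilon> (simple_root s) = 1")
    case True
    then have "\<epsilon> \<beta> = 1" if "\<beta> \<in> ?E" for \<beta>
      using transitive_coloring_constant[OF less.prems] that by blast
    then have "\<epsilon> \<beta> = coloring \<one> \<beta>" for \<beta>
      by (cases "\<beta> \<in> ?E") (auto simp: coloring_def positive_roots_iff PiE_arb[OF ext])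
    then show ?thesis by blast
  next
    case False
    then obtain s where s: "s \<in> S" "\<epsilon> (simple_root s) = 2"
      using ext simple_root_positive by fastforce
    \<comment> \<open>The reflection negates its own simple root; fixing that root instead gives an
      involution of the positive roots.\<close>
    define \<tau> where "\<tau> \<beta> = (if \<beta> = simple_root s then \<beta> else act s \<beta>)" for \<beta>
    have \<tau>_closed: "\<tau> \<beta> \<in> ?E" if "\<beta> \<in> ?E" for \<beta>
      using act_generator_positive_root(1)[OF s(1)] that by (auto simp: \<tau>_def)
    have \<tau>_\<tau>: "\<tau> (\<tau> \<beta>) = \<beta>" if "\<beta> \<in> ?E" for \<beta>
      using act_generator_positive_root(2)[OF s(1)] that s(1) by (simp add: \<tau>_def flip: act_mult)
    have bij: "bij_betw \<tau> ?E ?E"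
      by (rule bij_betw_byWitness[of _ \<tau>]) (use \<tau>_closed \<tau>_\<tau> in auto)
    \<comment> \<open>If \<epsilon> were the coloring of \<open>h\<close>, this would be the
      coloring of \<open>h \<otimes> s\<close>.\<close>
    define \<delta> where "\<delta> = (\<lambda>\<beta>\<in>?E. if \<beta> = simple_root s then 1 else \<epsilon> (act s \<beta>))"
    have \<delta>_ext: "\<delta> \<in> ?E \<rightarrow>\<^sub>E {1, 2}"
    proof (rule PiE_I)
      fix \<beta> assume "\<beta> \<in> ?E"
      then show "\<delta> \<beta> \<in> {1, 2}"
        using PiE_mem[OF ext, of "act s \<beta>"] act_generator_positive_root(1)[OF s(1)]
        by (simp add: \<delta>_def)
    qed (simp add: \<delta>_def)
    \<comment> \<open>At the simple root of \<open>s\<close>, the change of color compensates for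
      the sign of the reflection. Hence \<open>act s\<close> turns a signed relation for \<delta>
      with coefficients \<open>c\<close> into one for \<epsilon> with coefficients \<open>c\<close>
      composed with \<tau>.\<close>
    have signed: "(if \<delta> \<beta> = 1 then 1 else - 1) *\<^sub>R act s \<beta> = (if \<epsilon> (\<tau> \<beta>) = 1 then 1 else - 1 :: real) *\<^sub>R \<tau> \<beta>"
      if "\<beta> \<in> ?E" for \<beta>
      using that s by (simp add: \<delta>_def \<tau>_def act_generator_simple_root)
    have "\<forall>\<beta>\<in>?E. c \<beta> = 0"
      if c: "\<forall>\<beta>\<in>?E. (0::real) \<le> c \<beta>" "(\<Sum>\<beta>\<in>?E. (c \<beta> * (if \<delta> \<beta> = 1 then 1 else - 1)) *\<^sub>R \<beta>) = 0" for c
    proof -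
      have "(\<Sum>\<beta>\<in>?E. (c (\<tau> \<beta>) * (if \<epsilon> \<beta> = 1 then 1 else - 1)) *\<^sub>R \<beta>)
          = (\<Sum>\<beta>\<in>?E. (c (\<tau> (\<tau> \<beta>)) * (if \<epsilon> (\<tau> \<beta>) = 1 then 1 else - 1)) *\<^sub>R \<tau> \<beta>)"
        by (rule sum.reindex_bij_betw[OF bij, symmetric])
      also have "\<dots> = (\<Sum>\<beta>\<in>?E. (c \<beta> * (if \<delta> \<beta> = 1 then 1 else - 1)) *\<^sub>R act s \<beta>)"
        by (intro sum.cong refl) (simp only: \<tau>_\<tau> signed flip: scaleR_scaleR)
      also have "\<dots> = act s (\<Sum>\<beta>\<in>?E. (c \<beta> * (if \<delta> \<beta> = 1 then 1 else - 1)) *\<^sub>R \<beta>)"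
        by (simp add: linear_sum[OF linear_act] linear_scale[OF linear_act])
      also have "\<dots> = 0" using c(2) by (simp add: linear_0[OF linear_act])
      finally have "\<forall>\<beta>\<in>?E. c (\<tau> \<beta>) = 0"
        using less.prems[unfolded transitive_2_colorings_positive_roots, THEN conjunct2,
            THEN spec, of "\<lambda>\<beta>. c (\<tau> \<beta>)"] c(1) \<tau>_closed by blast
      then show ?thesis using \<tau>_closed \<tau>_\<tau> by metis
    qed
    then have \<delta>: "\<delta> \<in> transitive_2_colorings ?E"
      using \<delta>_ext unfolding transitive_2_colorings_positive_roots by blast
    \<comment> \<open>\<tau> maps the roots that \<delta> colors 2 injectively to those that
      \<epsilon> colors 2, missing the simple root of \<open>s\<close>; so the count strictly
      decreases.\<close>
    have "card {\<beta> \<in> ?E. \<delta> \<beta> = 2} \<le> card ({\<beta> \<in> ?E. \<epsilon> \<beta> = 2} - {simple_root s})"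
    proof (rule card_inj_on_le)
      show "inj_on \<tau> {\<beta> \<in> ?E. \<delta> \<beta> = 2}"
        using bij by (auto simp: bij_betw_def intro: inj_on_subset)
      show "\<tau> ` {\<beta> \<in> ?E. \<delta> \<beta> = 2} \<subseteq> {\<beta> \<in> ?E. \<epsilon> \<beta> = 2} - {simple_root s}"
        using act_generator_positive_root[OF s(1)] by (auto simp: \<delta>_def \<tau>_def split: if_splits)
    qed (simp add: finite_positive_roots)
    also have "\<dots> < card {\<beta> \<in> ?E. \<epsilon> \<beta> = 2}"
      using s simple_root_positive finite_positive_roots by (intro card_Diff1_less) auto
    finally obtain g where g: "g \<in> carrier G" "\<delta> = coloring g"
      using less.hyps \<delta> by blast
    have "\<epsilon> \<beta> = coloring (g \<otimes> s) \<beta>" for \<beta>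
    proof (cases "\<beta> \<in> ?E")
      case False
      then show ?thesis by (simp add: coloring_def PiE_arb[OF ext])
    next
      case \<beta>: True
      show ?thesis
      proof (cases "\<beta> = simple_root s")
        case True
        have "coloring g \<beta> = 1" using \<beta> True by (simp add: \<delta>_def flip: g(2))
        then have "nonneg (act g \<beta>)" using \<beta> by (simp add: coloring_def split: if_splits)
        then have "\<not> nonneg (act (g \<otimes> s) \<beta>)"
          using True g(1) s nonneg_act_uminus_iff[OF g(1)] simple_root_in_roots
          by (simp add: act_mult act_generator_simple_root)
        then show ?thesis using \<beta> True s by (simp add: coloring_def)
      next
        case False
        then have s\<beta>: "act s \<beta> \<in> ?E" "act s \<beta> \<noteq> simple_root s"
          using act_generator_positive_root s \<beta> by auto
        then have "coloring g (act s \<beta>) = \<epsilon> \<beta>"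
          using s by (simp add: \<delta>_def flip: g(2) act_mult)
        then show ?thesis
          using s\<beta> \<beta> g s by (simp add: coloring_def act_mult)
      qed
    qed
    then show ?thesis using g s by blast
  qed
qed

lemma bij_betw_coloring:
  "bij_betw coloring (carrier G) (transitive_2_colorings (positive_roots S m))"
  using inj_on_coloring coloring_transitive ex_coloring_eq by (auto simp: bij_betw_def)

end

end

theorem corollary2p24:
  fixes G :: "('a, 'b) monoid_scheme" and S :: "'a set" and m :: "'a \<Rightarrow> 'a \<Rightarrow> nat"
  assumes "coxeter_system G S m"
    and "finite (carrier G)"
  shows "card (transitive_2_colorings (positive_roots S m)) = order G"
  using bij_betw_same_card[OF coxeter_system.bij_betw_coloring[OF assms]]
  by (simp add: order_def)

end
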